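(* Let $A$ be an associative triple trisystem of the first kind over $\phi$, with triple products $\{\,,\,,\,\}_1,\{\,,\,,\,\}_2,\{\,,\,,\,\}_3$. Then $A$ is a Jordan triple disystem with respect to the two trilinear products defined, for all $a,b,c\in A$, by $$\langle a,b,c\rangle_1=\{a,b,c\}_1+\{c,b,a\}_3,\qquad \langle a,b,c\rangle_2=\{a,b,c\}_2+\{c,b,a\}_2 .$$
   Context: $\phi$ is a scalar ring (commutative, unital) with $\frac12\in\phi$. An associative triple trisystem of the first kind is a $\phi$-module $A$ with three trilinear maps $\{\,,\,,\,\}_i:A\times A\times A\to A$, $i\in\{1,2,3\}$, satisfying for all $a,b,c,d,e\in A$: (1) $\{\{a,b,c\}_1,d,e\}_1=\{a,\{b,c,d\}_1,e\}_1=\{a,b,\{c,d,e\}_1\}_1$; (2) $\{\{a,b,c\}_2,d,e\}_1=\{a,\{b,c,d\}_1,e\}_2=\{a,b,\{c,d,e\}_1\}_2$; (3) $\{\{a,b,c\}_3,d,e\}_1=\{a,\{b,c,d\}_2,e\}_2=\{a,b,\{c,d,e\}_1\}_3$; (4) $\{\{a,b,c\}_3,d,e\}_2=\{a,\{b,c,d\}_3,e\}_2=\{a,b,\{c,d,e\}_2\}_3$; (5) $\{\{a,b,c\}_3,d,e\}_3=\{a,\{b,c,d\}_3,e\}_3=\{a,b,\{c,d,e\}_3\}_3$; (6) $\{\{a,b,c\}_1,d,e\}_2=\{\{a,b,c\}_2,d,e\}_2=\{\{a,b,c\}_3,d,e\}_2$; (7) $\{\{a,b,c\}_1,d,e\}_3=\{\{a,b,c\}_2,d,e\}_3=\{\{a,b,c\}_3,d,e\}_3$;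 (8) $\{a,\{b,c,d\}_1,e\}_1=\{a,\{b,c,d\}_2,e\}_1=\{a,\{b,c,d\}_3,e\}_1$; (9) $\{a,\{b,c,d\}_1,e\}_3=\{a,\{b,c,d\}_2,e\}_3=\{a,\{b,c,d\}_3,e\}_3$; (10) $\{a,b,\{c,d,e\}_1\}_1=\{a,b,\{c,d,e\}_2\}_1=\{a,b,\{c,d,e\}_3\}_1$; (11) $\{a,b,\{c,d,e\}_1\}_2=\{a,b,\{c,d,e\}_2\}_2=\{a,b,\{c,d,e\}_3\}_2$. A Jordan triple disystem is a $\phi$-module $D$ with two trilinear operations $\langle\,,\,,\,\rangle_i:D\times D\times D\to D$, $i\in\{1,2\}$, satisfying for all $a,b,c,d,e\in D$: (JTD1) $\langle a,b,c\rangle_2=\langle c,b,a\rangle_2$; (JTD2) $\langle a,\langle b,c,d\rangle_1,e\rangle_1=\langle a,\langle b,c,d\rangle_2,e\rangle_1$; (JTD3) $\langle a,b,\langle c,d,e\rangle_1\rangle_1=\langle a,b,\langle c,d,e\rangle_2\rangle_1$; (JTD4) $\langle\langle a,b,c\rangle_1,d,e\rangle_2=\langle\langle a,b,c\rangle_2,d,e\rangle_2$; (JTD5) $\langle\langle e,d,c\rangle_1,b,a\rangle_1=\langle\langle e,b,a\rangle_1,d,c\rangle_1-\langle e,\langle d,a,b\rangle_1,c\rangle_1+\langle e,d,\langle c,b,a\rangle_1\rangle_1$; (JTD6) $\langle\langle e,d,c\rangle_2,b,a\rangle_1=\langle\langle e,b,a\rangle_1,d,c\rangle_2-\langle e,\langle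 d,a,b\rangle_1,c\rangle_2+\langle e,d,\langle c,b,a\rangle_1\rangle_2$; (JTD7) $\langle a,b,\langle c,d,e\rangle_1\rangle_1=\langle\langle a,b,c\rangle_1,d,e\rangle_1-\langle c,\langle b,a,d\rangle_2,e\rangle_2+\langle\langle a,b,e\rangle_1,d,c\rangle_1$; (JTD8) $\langle a,b,\langle c,d,e\rangle_1\rangle_2=\langle\langle a,b,c\rangle_2,d,e\rangle_1-\langle c,\langle b,a,d\rangle_1,e\rangle_2+\langle\langle a,b,e\rangle_2,d,c\rangle_1$. *)

theory Defs
  imports Complex_Main
begin

text \<open>Modules over a scalar ring are rendered by the library locale \<^locale>\<open>module\<close>: the ring of
  scalars is a type of class \<^class>\<open>comm_ring_1\<close>, the module is the additive group of a type together
  with a scalar multiplication.\<close>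

definition trilinear :: "('k::comm_ring_1 \<Rightarrow> 'a::ab_group_add \<Rightarrow> 'a) \<Rightarrow> ('a \<Rightarrow> 'a \<Rightarrow> 'a \<Rightarrow> 'a) \<Rightarrow> bool"
  where "trilinear scale f \<longleftrightarrow>
    (\<forall>b c. module_hom scale scale (\<lambda>a. f a b c)) \<and>
    (\<forall>a c. module_hom scale scale (\<lambda>b. f a b c)) \<and>
    (\<forall>a b. module_hom scale scale (\<lambda>c. f a b c))"

locale assoc_triple_trisystem_1 = module scale
  for scale :: "'k::comm_ring_1 \<Rightarrow> 'a::ab_group_add \<Rightarrow> 'a" +
  fixes t1 :: "'a \<Rightarrow> 'a \<Rightarrow> 'a \<Rightarrow> 'a"  (\<open>\<lbrace>_,_,_\<rbrace>\<^sub>1\<close>)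
    and t2 :: "'a \<Rightarrow> 'a \<Rightarrow> 'a \<Rightarrow> 'a"  (\<open>\<lbrace>_,_,_\<rbrace>\<^sub>2\<close>)
    and t3 :: "'a \<Rightarrow> 'a \<Rightarrow> 'a \<Rightarrow> 'a"  (\<open>\<lbrace>_,_,_\<rbrace>\<^sub>3\<close>)
  assumes trilinear1: "trilinear scale t1"
      and trilinear2: "trilinear scale t2"
      and trilinear3: "trilinear scale t3"
      and ATT1: "\<lbrace>\<lbrace>a,b,c\<rbrace>\<^sub>1,d,e\<rbrace>\<^sub>1 = \<lbrace>a,\<lbrace>b,c,d\<rbrace>\<^sub>1,e\<rbrace>\<^sub>1"
        "\<lbrace>a,\<lbrace>b,c,d\<rbrace>\<^sub>1,e\<rbrace>\<^sub>1 = \<lbrace>a,b,\<lbrace>c,d,e\<rbrace>\<^sub>1\<rbrace>\<^sub>1"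
      and ATT2: "\<lbrace>\<lbrace>a,b,c\<rbrace>\<^sub>2,d,e\<rbrace>\<^sub>1 = \<lbrace>a,\<lbrace>b,c,d\<rbrace>\<^sub>1,e\<rbrace>\<^sub>2"
        "\<lbrace>a,\<lbrace>b,c,d\<rbrace>\<^sub>1,e\<rbrace>\<^sub>2 = \<lbrace>a,b,\<lbrace>c,d,e\<rbrace>\<^sub>1\<rbrace>\<^sub>2"
      and ATT3: "\<lbrace>\<lbrace>a,b,c\<rbrace>\<^sub>3,d,e\<rbrace>\<^sub>1 = \<lbrace>a,\<lbrace>b,c,d\<rbrace>\<^sub>2,e\<rbrace>\<^sub>2"
        "\<lbrace>a,\<lbrace>b,c,d\<rbrace>\<^sub>2,e\<rbrace>\<^sub>2 = \<lbrace>a,b,\<lbrace>c,d,e\<rbrace>\<^sub>1\<rbrace>\<^sub>3"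
      and ATT4: "\<lbrace>\<lbrace>a,b,c\<rbrace>\<^sub>3,d,e\<rbrace>\<^sub>2 = \<lbrace>a,\<lbrace>b,c,d\<rbrace>\<^sub>3,e\<rbrace>\<^sub>2"
        "\<lbrace>a,\<lbrace>b,c,d\<rbrace>\<^sub>3,e\<rbrace>\<^sub>2 = \<lbrace>a,b,\<lbrace>c,d,e\<rbrace>\<^sub>2\<rbrace>\<^sub>3"
      and ATT5: "\<lbrace>\<lbrace>a,b,c\<rbrace>\<^sub>3,d,e\<rbrace>\<^sub>3 = \<lbrace>a,\<lbrace>b,c,d\<rbrace>\<^sub>3,e\<rbrace>\<^sub>3"
        "\<lbrace>a,\<lbrace>b,c,d\<rbrace>\<^sub>3,e\<rbrace>\<^sub>3 = \<lbrace>a,b,\<lbrace>c,d,e\<rbrace>\<^sub>3\<rbrace>\<^sub>3"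
      and ATT6: "\<lbrace>\<lbrace>a,b,c\<rbrace>\<^sub>1,d,e\<rbrace>\<^sub>2 = \<lbrace>\<lbrace>a,b,c\<rbrace>\<^sub>2,d,e\<rbrace>\<^sub>2"
        "\<lbrace>\<lbrace>a,b,c\<rbrace>\<^sub>2,d,e\<rbrace>\<^sub>2 = \<lbrace>\<lbrace>a,b,c\<rbrace>\<^sub>3,d,e\<rbrace>\<^sub>2"
      and ATT7: "\<lbrace>\<lbrace>a,b,c\<rbrace>\<^sub>1,d,e\<rbrace>\<^sub>3 = \<lbrace>\<lbrace>a,b,c\<rbrace>\<^sub>2,d,e\<rbrace>\<^sub>3"
        "\<lbrace>\<lbrace>a,b,c\<rbrace>\<^sub>2,d,e\<rbrace>\<^sub>3 = \<lbrace>\<lbrace>a,b,c\<rbrace>\<^sub>3,d,e\<rbrace>\<^sub>3"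
      and ATT8: "\<lbrace>a,\<lbrace>b,c,d\<rbrace>\<^sub>1,e\<rbrace>\<^sub>1 = \<lbrace>a,\<lbrace>b,c,d\<rbrace>\<^sub>2,e\<rbrace>\<^sub>1"
        "\<lbrace>a,\<lbrace>b,c,d\<rbrace>\<^sub>2,e\<rbrace>\<^sub>1 = \<lbrace>a,\<lbrace>b,c,d\<rbrace>\<^sub>3,e\<rbrace>\<^sub>1"
      and ATT9: "\<lbrace>a,\<lbrace>b,c,d\<rbrace>\<^sub>1,e\<rbrace>\<^sub>3 = \<lbrace>a,\<lbrace>b,c,d\<rbrace>\<^sub>2,e\<rbrace>\<^sub>3"
        "\<lbrace>a,\<lbrace>b,c,d\<rbrace>\<^sub>2,e\<rbrace>\<^sub>3 = \<lbrace>a,\<lbrace>b,c,d\<rbrace>\<^sub>3,e\<rbrace>\<^sub>3"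
      and ATT10: "\<lbrace>a,b,\<lbrace>c,d,e\<rbrace>\<^sub>1\<rbrace>\<^sub>1 = \<lbrace>a,b,\<lbrace>c,d,e\<rbrace>\<^sub>2\<rbrace>\<^sub>1"
        "\<lbrace>a,b,\<lbrace>c,d,e\<rbrace>\<^sub>2\<rbrace>\<^sub>1 = \<lbrace>a,b,\<lbrace>c,d,e\<rbrace>\<^sub>3\<rbrace>\<^sub>1"
      and ATT11: "\<lbrace>a,b,\<lbrace>c,d,e\<rbrace>\<^sub>1\<rbrace>\<^sub>2 = \<lbrace>a,b,\<lbrace>c,d,e\<rbrace>\<^sub>2\<rbrace>\<^sub>2"
        "\<lbrace>a,b,\<lbrace>c,d,e\<rbrace>\<^sub>2\<rbrace>\<^sub>2 = \<lbrace>a,b,\<lbrace>c,d,e\<rbrace>\<^sub>3\<rbrace>\<^sub>2"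

locale jordan_triple_disystem = module scale
  for scale :: "'k::comm_ring_1 \<Rightarrow> 'a::ab_group_add \<Rightarrow> 'a" +
  fixes p1 :: "'a \<Rightarrow> 'a \<Rightarrow> 'a \<Rightarrow> 'a"  (\<open>\<langle>_,_,_\<rangle>\<^sub>1\<close>)
    and p2 :: "'a \<Rightarrow> 'a \<Rightarrow> 'a \<Rightarrow> 'a"  (\<open>\<langle>_,_,_\<rangle>\<^sub>2\<close>)
  assumes trilinear1: "trilinear scale p1"
      and trilinear2: "trilinear scale p2"
      and JTD1: "\<langle>a,b,c\<rangle>\<^sub>2 = \<langle>c,b,a\<rangle>\<^sub>2"
      and JTD2: "\<langle>a,\<langle>b,c,d\<rangle>\<^sub>1,e\<rangle>\<^sub>1 = \<langle>a,\<langle>b,c,d\<rangle>\<^sub>2,e\<rangle>\<^sub>1"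
      and JTD3: "\<langle>a,b,\<langle>c,d,e\<rangle>\<^sub>1\<rangle>\<^sub>1 = \<langle>a,b,\<langle>c,d,e\<rangle>\<^sub>2\<rangle>\<^sub>1"
      and JTD4: "\<langle>\<langle>a,b,c\<rangle>\<^sub>1,d,e\<rangle>\<^sub>2 = \<langle>\<langle>a,b,c\<rangle>\<^sub>2,d,e\<rangle>\<^sub>2"
      and JTD5: "\<langle>\<langle>e,d,c\<rangle>\<^sub>1,b,a\<rangle>\<^sub>1 =
        \<langle>\<langle>e,b,a\<rangle>\<^sub>1,d,c\<rangle>\<^sub>1 - \<langle>e,\<langle>d,a,b\<rangle>\<^sub>1,c\<rangle>\<^sub>1 + \<langle>e,d,\<langle>c,b,a\<rangle>\<^sub>1\<rangle>\<^sub>1"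
      and JTD6: "\<langle>\<langle>e,d,c\<rangle>\<^sub>2,b,a\<rangle>\<^sub>1 =
        \<langle>\<langle>e,b,a\<rangle>\<^sub>1,d,c\<rangle>\<^sub>2 - \<langle>e,\<langle>d,a,b\<rangle>\<^sub>1,c\<rangle>\<^sub>2 + \<langle>e,d,\<langle>c,b,a\<rangle>\<^sub>1\<rangle>\<^sub>2"
      and JTD7: "\<langle>a,b,\<langle>c,d,e\<rangle>\<^sub>1\<rangle>\<^sub>1 =
        \<langle>\<langle>a,b,c\<rangle>\<^sub>1,d,e\<rangle>\<^sub>1 - \<langle>c,\<langle>b,a,d\<rangle>\<^sub>2,e\<rangle>\<^sub>2 + \<langle>\<langle>a,b,e\<rangle>\<^sub>1,d,c\<rangle>\<^sub>1"
      and JTD8: "\<langle>a,b,\<langle>c,d,e\<rangle>\<^sub>1\<rangle>\<^sub>2 =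
        \<langle>\<langle>a,b,c\<rangle>\<^sub>2,d,e\<rangle>\<^sub>1 - \<langle>c,\<langle>b,a,d\<rangle>\<^sub>1,e\<rangle>\<^sub>2 + \<langle>\<langle>a,b,e\<rangle>\<^sub>2,d,c\<rangle>\<^sub>1"

end

theory Submission
  imports Defs
begin

lemma trilinear_add:
  assumes "module scale" "trilinear scale f" "trilinear scale g"
  shows "trilinear scale (\<lambda>a b c. f a b c + g a b c)"
proof -
  interpret module_pair scale scale
    using assms(1) by (simp add: module_pair_def)
  show ?thesis
    using assms(2,3) by (simp add: trilinear_def module_hom_add)
qed

lemma trilinear_rev: "trilinear scale f \<Longrightarrow> trilinear scale (\<lambda>a b c. f c b a)"
  by (simp add: trilinear_def)

text \<open>Turns the \<open>module_hom\<close> conditions into rewrite rules that expand nested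
  products of sums.\<close>

lemma trilinear_add_args:
  assumes "trilinear scale f"
  shows "f (x + y) b c = f x b c + f y b c"
    and "f a (x + y) c = f a x c + f a y c"
    and "f a b (x + y) = f a b x + f a b y"
  using assms by (auto simp: trilinear_def module_hom_iff)

context assoc_triple_trisystem_1
begin

text \<open>Each product of two triple products depends only on the word \<open>a b c d e\<close> and on which of the
  five letters is central, the index of a product pointing to its central factor. The rules below
  bring it to one of the five forms \<open>\<lbrace>a,b,\<lbrace>c,d,e\<rbrace>\<^sub>1\<rbrace>\<^sub>i\<close> and \<open>\<lbrace>a,b,\<lbrace>c,d,e\<rbrace>\<^sub>j\<rbrace>\<^sub>3\<close>.\<close>

lemma normalize_left:
  "\<lbrace>\<lbrace>a,b,c\<rbrace>\<^sub>1,d,e\<rbrace>\<^sub>1 = \<lbrace>a,b,\<lbrace>c,d,e\<rbrace>\<^sub>1\<rbrace>\<^sub>1"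
  "\<lbrace>\<lbrace>a,b,c\<rbrace>\<^sub>2,d,e\<rbrace>\<^sub>1 = \<lbrace>a,b,\<lbrace>c,d,e\<rbrace>\<^sub>1\<rbrace>\<^sub>2"
  "\<lbrace>\<lbrace>a,b,c\<rbrace>\<^sub>3,d,e\<rbrace>\<^sub>1 = \<lbrace>a,b,\<lbrace>c,d,e\<rbrace>\<^sub>1\<rbrace>\<^sub>3"
  "\<lbrace>\<lbrace>a,b,c\<rbrace>\<^sub>1,d,e\<rbrace>\<^sub>2 = \<lbrace>a,b,\<lbrace>c,d,e\<rbrace>\<^sub>2\<rbrace>\<^sub>3"
  "\<lbrace>\<lbrace>a,b,c\<rbrace>\<^sub>2,d,e\<rbrace>\<^sub>2 = \<lbrace>a,b,\<lbrace>c,d,e\<rbrace>\<^sub>2\<rbrace>\<^sub>3"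
  "\<lbrace>\<lbrace>a,b,c\<rbrace>\<^sub>3,d,e\<rbrace>\<^sub>2 = \<lbrace>a,b,\<lbrace>c,d,e\<rbrace>\<^sub>2\<rbrace>\<^sub>3"
  "\<lbrace>\<lbrace>a,b,c\<rbrace>\<^sub>1,d,e\<rbrace>\<^sub>3 = \<lbrace>a,b,\<lbrace>c,d,e\<rbrace>\<^sub>3\<rbrace>\<^sub>3"
  "\<lbrace>\<lbrace>a,b,c\<rbrace>\<^sub>2,d,e\<rbrace>\<^sub>3 = \<lbrace>a,b,\<lbrace>c,d,e\<rbrace>\<^sub>3\<rbrace>\<^sub>3"
  "\<lbrace>\<lbrace>a,b,c\<rbrace>\<^sub>3,d,e\<rbrace>\<^sub>3 = \<lbrace>a,b,\<lbrace>c,d,e\<rbrace>\<^sub>3\<rbrace>\<^sub>3"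
  \<comment> \<open>\<open>ATT6\<close> and \<open>ATT7\<close> raise an inner index to 3, where
    \<open>ATT4\<close> and \<open>ATT5\<close> apply.\<close>
  by (simp_all only: ATT1 ATT2 ATT3 ATT4 ATT5 ATT6 ATT7)

lemma normalize_middle:
  "\<lbrace>a,\<lbrace>b,c,d\<rbrace>\<^sub>1,e\<rbrace>\<^sub>1 = \<lbrace>a,b,\<lbrace>c,d,e\<rbrace>\<^sub>1\<rbrace>\<^sub>1"
  "\<lbrace>a,\<lbrace>b,c,d\<rbrace>\<^sub>2,e\<rbrace>\<^sub>1 = \<lbrace>a,b,\<lbrace>c,d,e\<rbrace>\<^sub>1\<rbrace>\<^sub>1"
  "\<lbrace>a,\<lbrace>b,c,d\<rbrace>\<^sub>3,e\<rbrace>\<^sub>1 = \<lbrace>a,b,\<lbrace>c,d,e\<rbrace>\<^sub>1\<rbrace>\<^sub>1"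
  "\<lbrace>a,\<lbrace>b,c,d\<rbrace>\<^sub>1,e\<rbrace>\<^sub>2 = \<lbrace>a,b,\<lbrace>c,d,e\<rbrace>\<^sub>1\<rbrace>\<^sub>2"
  "\<lbrace>a,\<lbrace>b,c,d\<rbrace>\<^sub>2,e\<rbrace>\<^sub>2 = \<lbrace>a,b,\<lbrace>c,d,e\<rbrace>\<^sub>1\<rbrace>\<^sub>3"
  "\<lbrace>a,\<lbrace>b,c,d\<rbrace>\<^sub>3,e\<rbrace>\<^sub>2 = \<lbrace>a,b,\<lbrace>c,d,e\<rbrace>\<^sub>2\<rbrace>\<^sub>3"
  "\<lbrace>a,\<lbrace>b,c,d\<rbrace>\<^sub>1,e\<rbrace>\<^sub>3 = \<lbrace>a,b,\<lbrace>c,d,e\<rbrace>\<^sub>3\<rbrace>\<^sub>3"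
  "\<lbrace>a,\<lbrace>b,c,d\<rbrace>\<^sub>2,e\<rbrace>\<^sub>3 = \<lbrace>a,b,\<lbrace>c,d,e\<rbrace>\<^sub>3\<rbrace>\<^sub>3"
  "\<lbrace>a,\<lbrace>b,c,d\<rbrace>\<^sub>3,e\<rbrace>\<^sub>3 = \<lbrace>a,b,\<lbrace>c,d,e\<rbrace>\<^sub>3\<rbrace>\<^sub>3"
  \<comment> \<open>\<open>ATT8\<close> is reversed because \<open>ATT1(2)\<close> starts from inner
    index 1, while \<open>ATT5(2)\<close> starts from 3. Outer index 2 points into the inner
    product, so there each inner index has its own law.\<close>
  by (simp_all only: ATT8[symmetric] ATT9 ATT1(2) ATT2(2) ATT3(2) ATT4(2) ATT5(2))

lemma normalize_right:
  "\<lbrace>a,b,\<lbrace>c,d,e\<rbrace>\<^sub>2\<rbrace>\<^sub>1 = \<lbrace>a,b,\<lbrace>c,d,e\<rbrace>\<^sub>1\<rbrace>\<^sub>1"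
  "\<lbrace>a,b,\<lbrace>c,d,e\<rbrace>\<^sub>3\<rbrace>\<^sub>1 = \<lbrace>a,b,\<lbrace>c,d,e\<rbrace>\<^sub>1\<rbrace>\<^sub>1"
  "\<lbrace>a,b,\<lbrace>c,d,e\<rbrace>\<^sub>2\<rbrace>\<^sub>2 = \<lbrace>a,b,\<lbrace>c,d,e\<rbrace>\<^sub>1\<rbrace>\<^sub>2"
  "\<lbrace>a,b,\<lbrace>c,d,e\<rbrace>\<^sub>3\<rbrace>\<^sub>2 = \<lbrace>a,b,\<lbrace>c,d,e\<rbrace>\<^sub>1\<rbrace>\<^sub>2"
  by (simp_all only: ATT10[symmetric] ATT11[symmetric])

lemmas normalize = normalize_left normalize_middle normalize_right

lemmas distribs = trilinear_add_args[OF trilinear1] trilinear_add_args[OF trilinear2]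
  trilinear_add_args[OF trilinear3]

end

theorem theorem2:
  fixes scale :: "'k::comm_ring_1 \<Rightarrow> 'a::ab_group_add \<Rightarrow> 'a"
    and t1 t2 t3 :: "'a \<Rightarrow> 'a \<Rightarrow> 'a \<Rightarrow> 'a"
  assumes half: "\<exists>h::'k. 2 * h = 1"
    and A: "assoc_triple_trisystem_1 scale t1 t2 t3"
  shows "jordan_triple_disystem scale
           (\<lambda>a b c. t1 a b c + t3 c b a)
           (\<lambda>a b c. t2 a b c + t2 c b a)"
proof -
  interpret assoc_triple_trisystem_1 scale t1 t2 t3 by (fact A)
  show ?thesis
  proof unfold_locales
    show "trilinear scale (\<lambda>a b c. t1 a b c + t3 c b a)"
      by (rule trilinear_add[OF module_axioms trilinear1 trilinear_rev[OF trilinear3]])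
    show "trilinear scale (\<lambda>a b c. t2 a b c + t2 c b a)"
      by (rule trilinear_add[OF module_axioms trilinear2 trilinear_rev[OF trilinear2]])
  \<comment> \<open>Both summands of the first new product have its first argument as central
    factor, those of the second its middle argument. A nested product is thus a sum of four words
    with one common central letter. In \<open>JTD2\<close> to \<open>JTD4\<close> the inner index
    does not affect that letter. In \<open>JTD5\<close> to \<open>JTD8\<close> the letter is the
    same in all terms, and the four subtracted words cancel against four of the eight added ones,
    leaving the left side.\<close>
  qed (simp_all add: distribs normalize algebra_simps)
qed

end
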